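(* Let $K, M$ be positive integers, $L>0$, $\Delta x = L/K$, $\Delta t>0$. Let $\mathcal{H}_{\mathrm d}:\mathbb{R}^K\to\mathbb{R}$ be a discrete energy $\mathcal{H}_{\mathrm d}(v)=\sum_{k=1}^K G_{\mathrm d}(v_k)\,\Delta x$, and let $\frac{\delta G_{\mathrm d}}{\delta(v,w)_k}$ be a discrete variational derivative of it (as defined in the context). Suppose that $u^{(m)}_k\in\mathbb{R}$ ($m=0,\dots,M$; $k\in\mathbb{Z}$) satisfies the discrete periodic boundary condition $u^{(m)}_{k+K}=u^{(m)}_k$ for all $k\in\mathbb{Z}$ and is a solution of the average-difference method $$\delta^+_x\,\delta^+_t\, u^{(m)}_k=\mu^+_x\,\frac{\delta G_{\mathrm d}}{\delta\left(u^{(m+1)},u^{(m)}\right)_k}\qquad (k\in\mathbb{Z},\ m=0,\dots,M-1).$$ Then $\mathcal{H}_{\mathrm d}(u^{(m+1)})=\mathcal{H}_{\mathrm d}(u^{(m)})$ for all $m=0,\dots,M-1$.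
   Context: Write $u^{(m)}=(u^{(m)}_1,\dots,u^{(m)}_K)^\top\in\mathbb{R}^K$. Vectors in $\mathbb{R}^K$ are identified with $K$-periodic sequences indexed by $k\in\mathbb{Z}$; all quantities indexed by $k$, including the discrete variational derivative, are extended $K$-periodically in $k$. Difference and average operators: the spatial forward difference is $\delta^+_x f_k=\frac{f_{k+1}-f_k}{\Delta x}$, the spatial forward average is $\mu^+_x f_k=\frac{f_{k+1}+f_k}{2}$, and the temporal forward difference is $\delta^+_t f^{(m)}=\frac{f^{(m+1)}-f^{(m)}}{\Delta t}$. Discrete energy: the setting is the partial differential equation $u_{tx}=\delta G/\delta u$, $L$-periodic in $x$, with energy $\mathcal{H}(u)=\int_0^L G(u,u_x,\dots)\,\mathrm{d}x$. For $v\in\mathbb{R}^K$, $G_{\mathrm d}(v_k)$ denotes a real-valued discrete approximation of $G(u,u_x,\dots)$ at the grid point $k$ (it may depend on the entries of $v$ at neighbouring grid points as well), and $\mathcal{H}_{\mathrm d}(v)=\sum_{k=1}^K G_{\mathrm d}(v_k)\,\Delta x$. Discrete variational derivative: a function assigning to each pair $(v,w)\in\mathbb{R}^K\times\mathbb{R}^K$ real numbers $\frac{\delta G_{\mathrm d}}{\delta(v,w)_k}$ ($k=1,\dots,K$) such that, for all $v,w\in\mathbb{R}^K$, $$\frac{\mathcal{H}_{\mathrm d}(v)-\mathcal{H}_{\mathrm d}(w)}{\Delta t}=\sum_{k=1}^K\frac{\delta G_{\mathrm d}}{\delta(v,w)_k}\,\frac{v_k-w_k}{\Delta t}\,\Delta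 x.$$ In particular, with $v=u^{(m+1)}$ and $w=u^{(m)}$ this reads $\delta^+_t\mathcal{H}_{\mathrm d}(u^{(m)})=\sum_{k=1}^K\frac{\delta G_{\mathrm d}}{\delta(u^{(m+1)},u^{(m)})_k}\,\delta^+_t u^{(m)}_k\,\Delta x$. *)

theory Defs
  imports Complex_Main "HOL-Library.FuncSet"
begin

(* \<real>\<^sup>K in the form of K-periodic sequences over the integers: each such
   sequence is determined by its entries at 1, ..., K, and these are arbitrary. *)
definition periodic_seqs :: "nat \<Rightarrow> (int \<Rightarrow> real) set" where
  "periodic_seqs K = {f. \<forall>k. f (k + int K) = f k}"

definition delta_x :: "real \<Rightarrow> (int \<Rightarrow> real) \<Rightarrow> int \<Rightarrow> real" where
  "delta_x dx f k = (f (k + 1) - f k) / dx"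

definition mu_x :: "(int \<Rightarrow> real) \<Rightarrow> int \<Rightarrow> real" where
  "mu_x f k = (f (k + 1) + f k) / 2"

definition delta_t :: "real \<Rightarrow> (nat \<Rightarrow> real) \<Rightarrow> nat \<Rightarrow> real" where
  "delta_t dt f m = (f (m + 1) - f m) / dt"

(* G v k stands for the local energy at grid point k, usually written G(v_k); it takes the
   whole of v because it may depend on neighbouring entries. *)
definition discrete_energy ::
  "nat \<Rightarrow> real \<Rightarrow> ((int \<Rightarrow> real) \<Rightarrow> int \<Rightarrow> real) \<Rightarrow> (int \<Rightarrow> real) \<Rightarrow> real" where
  "discrete_energy K dx G v = (\<Sum>k = 1..int K. G v k * dx)"

(* D v w k is the k-th component of the derivative at the pair (v, w), extended periodically
   in k. Nothing is required of D v w for sequences v, w that are not K-periodic. *)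
definition discrete_variational_derivative ::
  "nat \<Rightarrow> real \<Rightarrow> real \<Rightarrow> ((int \<Rightarrow> real) \<Rightarrow> int \<Rightarrow> real) \<Rightarrow>
   ((int \<Rightarrow> real) \<Rightarrow> (int \<Rightarrow> real) \<Rightarrow> int \<Rightarrow> real) \<Rightarrow> bool" where
  "discrete_variational_derivative K dx dt G D \<longleftrightarrow>
     D \<in> periodic_seqs K \<rightarrow> periodic_seqs K \<rightarrow> periodic_seqs K \<and>
     (\<forall>v \<in> periodic_seqs K. \<forall>w \<in> periodic_seqs K.
        (discrete_energy K dx G v - discrete_energy K dx G w) / dt =
        (\<Sum>k = 1..int K. D v w k * ((v k - w k) / dt) * dx))"

end

theory Submission
  imports Defs
begin

text \<open>
  Fix a time step and put \<open>a = D (u (m + 1)) (u m)\<close> and \<open>b = (u (m + 1) - u m) / dt\<close>. By the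
  defining property of the discrete variational derivative, the energy increment is a multiple of
  \<open>\<Sum>k. a k * b k\<close>, so energy conservation amounts to the orthogonality of \<open>a\<close> and \<open>b\<close> over one
  period. In the continuous case \<open>b' = a\<close> makes \<open>a b\<close> the exact derivative of \<open>b\<^sup>2 / 2\<close>. Discretely,
  the scheme equates a difference of \<open>b\<close> with an average of \<open>a\<close>, and no product rule turns
  \<open>a k * b k\<close> itself into a difference. The average of \<open>a b\<close> over two neighbouring points is one,
  however: from
  \[ 2 (a_k b_k + a_{k+1} b_{k+1})
     = (a_{k+1} + a_k)(b_{k+1} + b_k) + (a_{k+1} - a_k)(b_{k+1} - b_k), \]
  the scheme, used to replace \<open>a\<close> by \<open>b\<close> in the first product and \<open>b\<close> by \<open>a\<close> in the second, leaves
  a difference of squares of \<open>b\<close> plus a difference of squares of \<open>a\<close> (lemma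
  \<open>mu_x_mult_eq_delta_x\<close>). Over a period, averaging preserves sums and differences sum to zero
  (\<open>sum_mu_x_periodic\<close>, \<open>sum_delta_x_periodic\<close>), hence \<open>\<Sum>k. a k * b k = 0\<close>.
\<close>

lemma sum_shift_periodic:
  assumes "f \<in> periodic_seqs K"
  shows "(\<Sum>k = 1..int K. f (k + 1)) = (\<Sum>k = 1..int K. f k)"
proof (cases "K = 0")
  case False
  have "(\<Sum>k = 1..int K. f (k + 1)) = (\<Sum>k = 2..int K + 1. f k)"
    by (rule sum.reindex_bij_witness[of _ "\<lambda>k. k - 1" "\<lambda>k. k + 1"]) auto
  also have "{2..int K + 1} = insert (int K + 1) {2..int K}"
    using False by auto
  also have "sum f \<dots> = f (1 + int K) + sum f {2..int K}"
    by (simp add: add.commute)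
  also have "f (1 + int K) = f 1"
    using assms by (simp add: periodic_seqs_def)
  also have "f 1 + sum f {2..int K} = sum f (insert 1 {2..int K})"
    by simp
  also have "insert 1 {2..int K} = {1..int K}"
    using False by auto
  finally show ?thesis .
qed simp

lemma sum_mu_x_periodic:
  assumes "f \<in> periodic_seqs K"
  shows "(\<Sum>k = 1..int K. mu_x f k) = (\<Sum>k = 1..int K. f k)"
  using sum_shift_periodic[OF assms]
  by (simp add: mu_x_def sum.distrib flip: sum_divide_distrib)

lemma sum_delta_x_periodic:
  assumes "f \<in> periodic_seqs K"
  shows "(\<Sum>k = 1..int K. delta_x dx f k) = 0"
  using sum_shift_periodic[OF assms]
  by (simp add: delta_x_def sum_subtractf flip: sum_divide_distrib)

text \<open>
  Two discrete product rules, \<open>mu_x a * mu_x b = delta_x dx (b\<^sup>2) / 2\<close> and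
  \<open>delta_x dx a * delta_x dx b = delta_x dx (a\<^sup>2) / 2\<close>, hold because the hypothesis turns either
  left-hand side into the difference times the average of a single sequence. They combine through
  \<open>mu_x (a b) = mu_x a * mu_x b + (dx\<^sup>2 / 4) * delta_x dx a * delta_x dx b\<close>, which accounts for
  the weights \<open>1/2\<close> and \<open>dx\<^sup>2 / 8\<close>.
\<close>
lemma mu_x_mult_eq_delta_x:
  assumes "dx \<noteq> 0" and "delta_x dx b k = mu_x a k"
  shows "mu_x (\<lambda>j. a j * b j) k = delta_x dx (\<lambda>j. (b j)\<^sup>2 / 2 + dx\<^sup>2 / 8 * (a j)\<^sup>2) k"
proof -
  have scheme: "b (k + 1) - b k = dx * (a (k + 1) + a k) / 2"
    using assms by (simp add: delta_x_def mu_x_def field_simps)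
  have "dx * (a (k + 1) * b (k + 1) + a k * b k) =
      (dx * (a (k + 1) + a k) / 2) * (b (k + 1) + b k)
      + dx / 2 * (a (k + 1) - a k) * (b (k + 1) - b k)"
    by (simp add: field_simps)
  also have "\<dots> = (b (k + 1) - b k) * (b (k + 1) + b k)
      + dx / 2 * (a (k + 1) - a k) * (dx * (a (k + 1) + a k) / 2)"
    by (simp only: scheme)
  also have "\<dots> = 2 * (((b (k + 1))\<^sup>2 / 2 + dx\<^sup>2 / 8 * (a (k + 1))\<^sup>2)
      - ((b k)\<^sup>2 / 2 + dx\<^sup>2 / 8 * (a k)\<^sup>2))"
    by (simp add: field_simps power2_eq_square)
  finally show ?thesis
    using assms(1) by (simp add: mu_x_def delta_x_def field_simps)
qed

lemma sum_mult_eq_0_if_delta_x_eq_mu_x: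
  assumes "dx \<noteq> 0" and "a \<in> periodic_seqs K" and "b \<in> periodic_seqs K"
    and "\<And>k. delta_x dx b k = mu_x a k"
  shows "(\<Sum>k = 1..int K. a k * b k) = 0"
proof -
  have "(\<lambda>j. a j * b j) \<in> periodic_seqs K"
    using assms by (simp add: periodic_seqs_def)
  then have "(\<Sum>k = 1..int K. a k * b k) = (\<Sum>k = 1..int K. mu_x (\<lambda>j. a j * b j) k)"
    by (rule sum_mu_x_periodic[symmetric])
  also have "\<dots> = (\<Sum>k = 1..int K. delta_x dx (\<lambda>j. (b j)\<^sup>2 / 2 + dx\<^sup>2 / 8 * (a j)\<^sup>2) k)"
    by (simp only: mu_x_mult_eq_delta_x[OF assms(1,4)])
  also have "\<dots> = 0"
    by (rule sum_delta_x_periodic) (use assms in \<open>simp add: periodic_seqs_def\<close>)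
  finally show ?thesis .
qed

theorem theorem1:
  fixes K M :: nat
    and L dx dt :: real
    and G :: "(int \<Rightarrow> real) \<Rightarrow> int \<Rightarrow> real"
    and D :: "(int \<Rightarrow> real) \<Rightarrow> (int \<Rightarrow> real) \<Rightarrow> int \<Rightarrow> real"
    and u :: "nat \<Rightarrow> int \<Rightarrow> real"
  assumes "K > 0" and "M > 0" and "L > 0" and "dx = L / real K" and "dt > 0"
    and "G \<in> periodic_seqs K \<rightarrow> periodic_seqs K"
    and "discrete_variational_derivative K dx dt G D"
    and "\<And>m. m \<le> M \<Longrightarrow> u m \<in> periodic_seqs K"
    and "\<And>m k. m < M \<Longrightarrow>
      delta_x dx (\<lambda>j. delta_t dt (\<lambda>n. u n j) m) k = mu_x (D (u (m + 1)) (u m)) k"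
  shows "\<forall>m < M. discrete_energy K dx G (u (m + 1)) = discrete_energy K dx G (u m)"
proof (intro allI impI)
  fix m assume m: "m < M"
  define a where "a = D (u (m + 1)) (u m)"
  define b where "b = (\<lambda>j. (u (m + 1) j - u m j) / dt)"
  have u: "u (m + 1) \<in> periodic_seqs K" "u m \<in> periodic_seqs K"
    using assms(8) m by auto
  have a_per: "a \<in> periodic_seqs K"
    using assms(7) u unfolding a_def discrete_variational_derivative_def by blast
  have b_per: "b \<in> periodic_seqs K"
    using u by (simp add: b_def periodic_seqs_def)
  have scheme: "delta_x dx b k = mu_x a k" for k
    using assms(9)[OF m, of k] by (simp add: a_def b_def delta_t_def)
  have "dx \<noteq> 0"
    using assms(1,3,4) by simp
  then have orth: "(\<Sum>k = 1..int K. a k * b k) = 0"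
    using a_per b_per scheme by (rule sum_mult_eq_0_if_delta_x_eq_mu_x)
  have "(discrete_energy K dx G (u (m + 1)) - discrete_energy K dx G (u m)) / dt =
      (\<Sum>k = 1..int K. a k * b k * dx)"
    using assms(7) u unfolding a_def b_def discrete_variational_derivative_def by blast
  also have "\<dots> = 0"
    using orth by (simp flip: sum_distrib_right)
  finally show "discrete_energy K dx G (u (m + 1)) = discrete_energy K dx G (u m)"
    using assms(5) by simp
qed

end
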